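(* Let $\{z_n\}_{n\ge1}$ be a thin sequence in the open unit disc $\mathbb{D}$. Then for every $\varepsilon>0$ there exists $N$ such that for each $n\ge N$ there exists $f_n\in H^\infty$ such that for all $n,k\ge N$ $$f_n(z_n)=1,\qquad f_n(z_k)=0\ \text{ if } k\ne n,$$ and for all $z\in\mathbb{D}$ $$\sum_{n\ge N}|f_n(z)|<1+\varepsilon.$$ In particular, for every sequence $a\in\ell^\infty$ with $\|a\|_{\ell^\infty}\le1$, the function $g_a$ defined by $g_a(z):=\sum_{n\ge N}a_nf_n(z)$ belongs to $H^\infty$, satisfies $\|g_a\|_\infty\le(1+\varepsilon)\|a\|_{N,\ell^\infty}$, and $g_a(z_j)=a_j$ for all $j\ge N$.
   Context: $H^\infty$ is the algebra of bounded analytic functions on $\mathbb{D}$ with the supremum norm $\|\cdot\|_\infty$. A sequence $\{z_j\}\subset\mathbb{D}$ is thin if $\lim_{j\to\infty}\prod_{k\ne j}\left|\frac{z_j-z_k}{1-\overline{z_k}z_j}\right|=1$. For a sequence $a=\{a_j\}$ and a positive integer $N$, $\|a\|_{N,\ell^\infty}:=\sup_{j\ge N}|a_j|$. *)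

theory Defs
  imports "HOL-Complex_Analysis.Complex_Analysis"
begin

abbreviation unit_disc :: "complex set" where
  "unit_disc \<equiv> ball 0 1"

definition pseudo_hyp :: "complex \<Rightarrow> complex \<Rightarrow> real" where
  "pseudo_hyp w v = norm ((w - v) / (1 - cnj v * w))"

(* Sequences are functions on nat of which only the values at indices n >= 1 matter.
   The infinite product is the limit of its partial products; these decrease and are
   nonnegative, so the limit exists for every sequence in the disc.  The library's prodinf
   is unsuitable: its value is unspecified for products that diverge to 0. *)
definition sep_prod :: "(nat \<Rightarrow> complex) \<Rightarrow> nat \<Rightarrow> real" where
  "sep_prod z j = lim (\<lambda>m. \<Prod>k\<in>{1..m} - {j}. pseudo_hyp (z j) (z k))"

definition thin_seq :: "(nat \<Rightarrow> complex) \<Rightarrow> bool" where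
  "thin_seq z \<longleftrightarrow> (\<forall>j\<ge>1. z j \<in> unit_disc) \<and> sep_prod z \<longlonglongrightarrow> 1"

(* Functions on the disc are total functions whose values outside the disc are irrelevant. *)
definition Hinf :: "(complex \<Rightarrow> complex) set" where
  "Hinf = {f. f holomorphic_on unit_disc \<and> bounded (f ` unit_disc)}"

definition Hinf_norm :: "(complex \<Rightarrow> complex) \<Rightarrow> real" where
  "Hinf_norm f = (SUP w\<in>unit_disc. norm (f w))"

definition linf :: "(nat \<Rightarrow> complex) set" where
  "linf = {a. bounded (a ` {1..})}"

definition linf_norm :: "(nat \<Rightarrow> complex) \<Rightarrow> real" where
  "linf_norm a = (SUP j\<in>{1..}. norm (a j))"

definition linf_tail_norm :: "nat \<Rightarrow> (nat \<Rightarrow> complex) \<Rightarrow> real" where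
  "linf_tail_norm N a = (SUP j\<in>{N..}. norm (a j))"

definition interp_sum ::
  "nat \<Rightarrow> (nat \<Rightarrow> complex \<Rightarrow> complex) \<Rightarrow> (nat \<Rightarrow> complex) \<Rightarrow> complex \<Rightarrow> complex" where
  "interp_sum N f a w = (\<Sum>\<^sub>\<infinity>n\<in>{N..}. a n * f n w)"

end

theory Submission imports Defs begin

text \<open>
  Put \<open>s\<^sub>k(w) = (1 - |z\<^sub>k|\<^sup>2) / (1 - cnj z\<^sub>k w)\<close>, so that \<open>s\<^sub>k(z\<^sub>k) = 1\<close>, \<open>|1 - s\<^sub>k| \<le> 1\<close> and \<open>1 - s\<^sub>k\<close>
  is, up to the constant \<open>cnj z\<^sub>k\<close>, the Blaschke factor at \<open>z\<^sub>k\<close>. For \<open>c = \<beta>(\<beta> + 1)\<close> the function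
  \<open>G\<^sub>k = c s\<^sub>k\<^sup>2 / (1 + \<beta> s\<^sub>k)\<^sup>2\<close> satisfies \<open>|G\<^sub>k| \<le> 1 - |exp(-2c s\<^sub>k)|\<close> on the disc, while
  \<open>G\<^sub>k(z\<^sub>k) = \<beta>/(\<beta> + 1)\<close> is close to 1 for large \<open>\<beta>\<close>. Let
  \<open>h\<^sub>n = G\<^sub>n \<Prod> (1 - s\<^sub>k) exp(-2c s\<^sub>k)\<close>, the product over \<open>k \<ge> N\<close>, \<open>k \<noteq> n\<close>, with the exponential present
  only if \<open>|z\<^sub>k| \<ge> |z\<^sub>n|\<close>. The bound on \<open>|G\<^sub>n|\<close> makes \<open>\<Sum> |h\<^sub>n|\<close> telescope to at most 1.
  If \<open>|w| \<le> |z\<^sub>k|\<close>, then \<open>2 Re s\<^sub>k(w) \<le> (1 - |z\<^sub>k|\<^sup>2) + 2(1 - \<rho>(w, z\<^sub>k)\<^sup>2)\<close>; by thinness and the Blaschke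
  condition these terms have small sums at \<open>w = z\<^sub>n\<close>, so \<open>|h\<^sub>n(z\<^sub>n)|\<close> is close to 1 and
  \<open>f\<^sub>n = h\<^sub>n / h\<^sub>n(z\<^sub>n)\<close> has the required properties.
\<close>

section \<open>The normalised kernel\<close>

text \<open>The Szego kernel of the Hardy space at \<open>a\<close>, divided by its value at
  \<open>a\<close>.\<close>

definition disc_kernel :: "complex \<Rightarrow> complex \<Rightarrow> complex" where
  "disc_kernel a w = of_real (1 - (norm a)\<^sup>2) / (1 - cnj a * w)"

lemma norm_one_minus_cnj_mult_ge:
  assumes "a \<in> unit_disc"
  shows "1 - norm w \<le> norm (1 - cnj a * w)"
proof -
  have "norm (cnj a * w) \<le> norm w"
    using assms by (simp add: norm_mult mult_left_le_one_le)
  moreover have "norm (1::complex) - norm (cnj a * w) \<le> norm (1 - cnj a * w)"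
    by (rule norm_triangle_ineq2)
  ultimately show ?thesis by simp
qed

lemma one_minus_cnj_mult_nonzero:
  assumes "a \<in> unit_disc" "w \<in> unit_disc"
  shows "1 - cnj a * w \<noteq> 0"
  using norm_one_minus_cnj_mult_ge[OF assms(1), of w] assms(2) by auto

lemma norm_diff_sq_one_minus_cnj:
  "(norm (1 - cnj a * w))\<^sup>2 - (norm (w - a))\<^sup>2 = (1 - (norm a)\<^sup>2) * (1 - (norm w)\<^sup>2)"
  unfolding cmod_power2 by (simp add: algebra_simps power2_eq_square)

lemma one_minus_pseudo_hyp_sq:
  assumes "a \<in> unit_disc" "w \<in> unit_disc"
  shows "1 - (pseudo_hyp w a)\<^sup>2 = (1 - (norm a)\<^sup>2) * (1 - (norm w)\<^sup>2) / (norm (1 - cnj a * w))\<^sup>2"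
  using one_minus_cnj_mult_nonzero[OF assms]
  by (simp add: pseudo_hyp_def norm_divide power_divide diff_divide_eq_iff
      flip: norm_diff_sq_one_minus_cnj)

lemma norm_sq_le_1: "a \<in> unit_disc \<Longrightarrow> (norm a)\<^sup>2 \<le> 1"
  by (simp add: abs_square_le_1)

lemma pseudo_hyp_nonneg: "0 \<le> pseudo_hyp w a"
  by (simp add: pseudo_hyp_def)

lemma pseudo_hyp_le_1:
  assumes "a \<in> unit_disc" "w \<in> unit_disc"
  shows "pseudo_hyp w a \<le> 1"
proof -
  have "0 \<le> 1 - (pseudo_hyp w a)\<^sup>2"
    unfolding one_minus_pseudo_hyp_sq[OF assms] using assms by (simp add: norm_sq_le_1)
  then show ?thesis
    by (simp add: abs_square_le_1 pseudo_hyp_nonneg)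
qed

lemma one_minus_disc_kernel:
  assumes "a \<in> unit_disc" "w \<in> unit_disc"
  shows "1 - disc_kernel a w = cnj a * (a - w) / (1 - cnj a * w)"
  using one_minus_cnj_mult_nonzero[OF assms]
  by (simp add: disc_kernel_def diff_divide_eq_iff algebra_simps flip: complex_norm_square)

lemma norm_one_minus_disc_kernel:
  assumes "a \<in> unit_disc" "w \<in> unit_disc"
  shows "norm (1 - disc_kernel a w) = norm a * pseudo_hyp w a"
  unfolding one_minus_disc_kernel[OF assms] pseudo_hyp_def
  by (simp add: norm_mult norm_divide norm_minus_commute)

lemma norm_one_minus_disc_kernel_le_1:
  assumes "a \<in> unit_disc" "w \<in> unit_disc"
  shows "norm (1 - disc_kernel a w) \<le> 1"
  unfolding norm_one_minus_disc_kernel[OF assms]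
  using assms pseudo_hyp_le_1[OF assms] by (intro mult_le_one) (auto simp: pseudo_hyp_nonneg)

lemma disc_kernel_self: "a \<in> unit_disc \<Longrightarrow> disc_kernel a a = 1"
  using one_minus_disc_kernel[of a a] by simp

lemma norm_disc_kernel_le:
  assumes "a \<in> unit_disc" "w \<in> unit_disc"
  shows "norm (disc_kernel a w) \<le> (1 - (norm a)\<^sup>2) / (1 - norm w)"
proof -
  have "\<bar>1 - (norm a)\<^sup>2\<bar> = 1 - (norm a)\<^sup>2"
    using norm_sq_le_1[OF assms(1)] by simp
  then have "norm (disc_kernel a w) = (1 - (norm a)\<^sup>2) / norm (1 - cnj a * w)"
    unfolding disc_kernel_def norm_divide norm_of_real by simp
  also have "\<dots> \<le> (1 - (norm a)\<^sup>2) / (1 - norm w)"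
    using assms norm_one_minus_cnj_mult_ge[OF assms(1), of w] norm_sq_le_1[OF assms(1)]
    by (intro divide_left_mono mult_pos_pos) auto
  finally show ?thesis .
qed

lemma holomorphic_disc_kernel:
  "a \<in> unit_disc \<Longrightarrow> disc_kernel a holomorphic_on unit_disc"
  unfolding disc_kernel_def using one_minus_cnj_mult_nonzero by (auto intro!: holomorphic_intros)

text \<open>Expand |1 - s|^2. The disc of radius 1 about 1 is where squared moduli can be traded for
  real parts, and the moduli of the exponentials depend on real parts only.\<close>

lemma norm_sq_le_twice_Re:
  fixes s :: complex
  assumes "norm (1 - s) \<le> 1"
  shows "(norm s)\<^sup>2 \<le> 2 * Re s" and "0 \<le> Re s"
proof -
  have "(norm (1 - s))\<^sup>2 \<le> 1"
    using assms by (simp add: abs_square_le_1)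
  moreover have "(norm (1 - s))\<^sup>2 = 1 - 2 * Re s + (norm s)\<^sup>2"
    unfolding cmod_power2 by (simp add: algebra_simps power2_eq_square)
  ultimately show "(norm s)\<^sup>2 \<le> 2 * Re s"
    by simp
  with zero_le_power2[of "norm s"] show "0 \<le> Re s"
    by linarith
qed

text \<open>Write 2 Re s as |s|^2 + (1 - |1 - s|^2). Since |w| \<le> |a|, one factor 1 - |a|^2 of
  |s|^2 can be raised to 1 - |w|^2, so |s|^2 \<le> 1 - \<rho>^2. The other summand is 1 - |a|^2
  \<rho>^2 = (1 - |a|^2) + |a|^2 (1 - \<rho>^2).\<close>

lemma twice_Re_disc_kernel_le:
  assumes "a \<in> unit_disc" "w \<in> unit_disc" "norm w \<le> norm a"
  shows "2 * Re (disc_kernel a w) \<le> (1 - (norm a)\<^sup>2) + 2 * (1 - (pseudo_hyp w a)\<^sup>2)"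
proof -
  let ?s = "disc_kernel a w" and ?r = "1 - (pseudo_hyp w a)\<^sup>2"
  have a1: "(norm a)\<^sup>2 \<le> 1" by (rule norm_sq_le_1) fact
  have r0: "0 \<le> ?r"
    using pseudo_hyp_le_1[OF assms(1,2)] by (simp add: abs_square_le_1 pseudo_hyp_nonneg)
  have "(norm ?s)\<^sup>2 = (1 - (norm a)\<^sup>2) * (1 - (norm a)\<^sup>2) / (norm (1 - cnj a * w))\<^sup>2"
    unfolding disc_kernel_def norm_divide norm_of_real power_divide power2_abs
    by (simp add: power2_eq_square)
  also have "\<dots> \<le> (1 - (norm a)\<^sup>2) * (1 - (norm w)\<^sup>2) / (norm (1 - cnj a * w))\<^sup>2"
    using a1 assms(3) by (intro divide_right_mono mult_left_mono) auto
  finally have 1: "(norm ?s)\<^sup>2 \<le> ?r"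
    unfolding one_minus_pseudo_hyp_sq[OF assms(1,2)] .
  have "1 - (norm (1 - ?s))\<^sup>2 = (1 - (norm a)\<^sup>2) + (norm a)\<^sup>2 * ?r"
    unfolding norm_one_minus_disc_kernel[OF assms(1,2)] by (simp add: algebra_simps)
  also have "\<dots> \<le> (1 - (norm a)\<^sup>2) + ?r"
    using a1 r0 by (simp add: mult_left_le_one_le)
  finally have 2: "1 - (norm (1 - ?s))\<^sup>2 \<le> (1 - (norm a)\<^sup>2) + ?r" .
  have "2 * Re ?s = (norm ?s)\<^sup>2 + (1 - (norm (1 - ?s))\<^sup>2)"
    unfolding cmod_power2 by (simp add: algebra_simps power2_eq_square)
  with 1 2 show ?thesis by simp
qed

section \<open>The peak function\<close>

text \<open>For \<beta> > 0 this is (\<beta> + 1)/\<beta> times the square of \<beta>s/(1 +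
  \<beta>s). Squaring puts |s|^2 into the modulus, and 2 Re s dominates that when |1 - s| \<le>
  1.\<close>

definition peak :: "real \<Rightarrow> complex \<Rightarrow> complex" where
  "peak \<beta> s = of_real (\<beta> * (\<beta> + 1)) * s\<^sup>2 / (1 + of_real \<beta> * s)\<^sup>2"

lemma peak_denominator_ge:
  assumes "0 \<le> \<beta>" "0 \<le> Re s"
  shows "1 \<le> norm (1 + of_real \<beta> * s)"
  using complex_Re_le_cmod[of "1 + of_real \<beta> * s"] assms
  by (simp add: order_trans[of 1 "1 + \<beta> * Re s"])

text \<open>The modulus is nondecreasing in X = |s|^2, and X \<le> 2 Re s. At X = 2 Re s the
  numerator is u = 2\<beta>(\<beta> + 1) Re s and the denominator is exactly 1 + u, so the same
  constant \<beta>(\<beta> + 1) fits \<open>peak\<close> and the exponent. Then 1 + u \<le> exp u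
  finishes.\<close>

lemma norm_peak_le:
  assumes "0 \<le> \<beta>" "norm (1 - s) \<le> 1"
  shows "norm (peak \<beta> s) \<le> 1 - exp (- (2 * (\<beta> * (\<beta> + 1)) * Re s))"
proof -
  define x where "x = Re s"
  define X where "X = (norm s)\<^sup>2"
  define u where "u = 2 * (\<beta> * (\<beta> + 1)) * x"
  have x: "0 \<le> x" "X \<le> 2 * x" "0 \<le> X"
    using norm_sq_le_twice_Re[OF assms(2)] by (auto simp: x_def X_def)
  have u: "0 \<le> u"
    using x assms by (simp add: u_def)
  have den: "(norm (1 + of_real \<beta> * s))\<^sup>2 = 1 + 2 * \<beta> * x + \<beta>\<^sup>2 * X"
    unfolding cmod_power2 x_def X_def by (simp add: algebra_simps power2_eq_square)
  have den0: "0 < 1 + 2 * \<beta> * x + \<beta>\<^sup>2 * X"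
    using x assms by (simp add: add_pos_nonneg)
  have "norm (peak \<beta> s) = \<beta> * (\<beta> + 1) * X / (1 + 2 * \<beta> * x + \<beta>\<^sup>2 * X)"
    using assms by (simp add: peak_def norm_divide norm_mult norm_power den X_def
        flip: of_real_add of_real_mult)
  also have "\<dots> \<le> u / (1 + u)"
  proof -
    \<comment> \<open>Clearing denominators in the goal, the common term \<beta>^2 X u cancels; what
      remains is X \<le> 2x times nonnegative factors.\<close>
    have "X * (1 + 2 * \<beta> * x) \<le> 2 * x * (1 + 2 * \<beta> * x)"
      using x assms by (intro mult_right_mono) auto
    then have "\<beta> * (\<beta> + 1) * (X * (1 + 2 * \<beta> * x)) \<le> \<beta> * (\<beta> + 1) * (2 * x * (1 + 2 * \<beta> * x))"
      using assms by (intro mult_left_mono) auto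
    then show ?thesis
      using den0 u by (simp add: divide_simps) (simp add: u_def algebra_simps power2_eq_square)
  qed
  also have "\<dots> = 1 - 1 / (1 + u)"
    using u by (simp add: field_simps)
  also have "\<dots> \<le> 1 - exp (- u)"
    using u exp_ge_add_one_self[of u] le_imp_inverse_le[of "1 + u" "exp u"]
    by (simp add: exp_minus inverse_eq_divide)
  finally show ?thesis by (simp add: u_def x_def)
qed

text \<open>Uses 1 - exp(-u) \<le> u. Linearity in |s| supplies the summable majorants for the
  functions h_n.\<close>

lemma norm_peak_le_norm:
  assumes "0 \<le> \<beta>" "norm (1 - s) \<le> 1"
  shows "norm (peak \<beta> s) \<le> 2 * (\<beta> * (\<beta> + 1)) * norm s"
proof -
  have "norm (peak \<beta> s) \<le> 1 - exp (- (2 * (\<beta> * (\<beta> + 1)) * Re s))"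
    by (rule norm_peak_le) fact+
  also have "\<dots> \<le> 2 * (\<beta> * (\<beta> + 1)) * Re s"
    using exp_ge_add_one_self[of "- (2 * (\<beta> * (\<beta> + 1)) * Re s)"] by simp
  also have "\<dots> \<le> 2 * (\<beta> * (\<beta> + 1)) * norm s"
    using assms complex_Re_le_cmod[of s] by (intro mult_left_mono) auto
  finally show ?thesis .
qed

section \<open>Products and sums of functions on the disc\<close>

text \<open>The derivative of exp has modulus at most 1 on the closed left half-plane, a convex set
  containing 0 and \<open>w\<close>.\<close>

lemma norm_exp_minus_one_le:
  fixes w :: complex
  assumes "Re w \<le> 0"
  shows "norm (exp w - 1) \<le> norm w"
proof -
  have "norm (exp w - exp 0) \<le> 1 * norm (w - 0)"
    by (rule field_differentiable_bound[of "{v. Re v \<le> 0}" exp exp])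
       (use assms in \<open>auto intro!: derivative_eq_intros convex_halfspace_Re_le\<close>)
  then show ?thesis by simp
qed

text \<open>With e the exponential, split the difference as (e - 1) - s e, where |e| \<le> 1.
  Linearity in |s| makes infinite products of such factors converge.\<close>

lemma norm_damped_factor_minus_one_le:
  fixes s :: complex
  assumes "norm (1 - s) \<le> 1" "0 \<le> \<gamma>"
  shows "norm ((1 - s) * exp (- (of_real \<gamma> * s)) - 1) \<le> (1 + \<gamma>) * norm s"
proof -
  let ?e = "exp (- (of_real \<gamma> * s))"
  have re: "0 \<le> \<gamma> * Re s"
    using norm_sq_le_twice_Re[OF assms(1)] assms(2) by simp
  have "norm ?e \<le> 1"
    using re by simp
  then have "norm (s * ?e) \<le> norm s"
    unfolding norm_mult by (intro mult_left_le) auto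
  moreover have "norm (?e - 1) \<le> norm (- (of_real \<gamma> * s))"
    using re by (intro norm_exp_minus_one_le) simp
  then have "norm (?e - 1) \<le> \<gamma> * norm s"
    using assms(2) by (simp add: norm_mult)
  moreover have "(1 - s) * ?e - 1 = (?e - 1) - s * ?e"
    by (simp add: algebra_simps)
  then have "norm ((1 - s) * ?e - 1) \<le> norm (?e - 1) + norm (s * ?e)"
    by (simp only: norm_triangle_ineq4)
  ultimately show ?thesis
    by (simp add: algebra_simps)
qed

section \<open>Telescoping sums of weighted products\<close>

lemma prod_antimono_le_1:
  fixes Q :: "'a \<Rightarrow> real"
  assumes "finite B" "A \<subseteq> B" and "\<And>k. k \<in> B \<Longrightarrow> 0 \<le> Q k \<and> Q k \<le> 1"
  shows "prod Q B \<le> prod Q A"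
proof -
  have "prod Q B = prod Q (B - A) * prod Q A"
    using assms by (intro prod.subset_diff)
  also have "\<dots> \<le> 1 * prod Q A"
    using assms by (intro mult_right_mono prod_le_1 prod_nonneg) auto
  finally show ?thesis by simp
qed

lemma sum_weights_prod_le:
  fixes Q :: "'a \<Rightarrow> real" and r :: "'a \<Rightarrow> real"
  assumes "finite F" and "\<And>k. k \<in> F \<Longrightarrow> 0 \<le> Q k \<and> Q k \<le> 1"
  shows "(\<Sum>n\<in>F. (1 - Q n) * (\<Prod>k\<in>{k\<in>F. k \<noteq> n \<and> r n \<le> r k}. Q k)) \<le> 1 - (\<Prod>k\<in>F. Q k)"
  using assms
\<comment> \<open>Inserting elements by decreasing \<open>r\<close>: the new product then runs over all of the old set, and the
    old products can only decrease.\<close>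
proof (induction F rule: finite_ranking_induct[where f = "\<lambda>k. - r k"])
  case empty
  then show ?case by simp
next
  case (insert x S)
  show ?case
  proof (cases "x \<in> S")
    case True
    then show ?thesis using insert by (simp add: insert_absorb)
  next
    case False
    let ?T = "\<lambda>F n. \<Prod>k\<in>{k\<in>F. k \<noteq> n \<and> r n \<le> r k}. Q k"
    have eq: "{k \<in> insert x S. k \<noteq> x \<and> r x \<le> r k} = S"
      using False insert.hyps(2) by auto
    have le: "?T (insert x S) n \<le> ?T S n" for n
      using insert.prems insert.hyps(1) by (intro prod_antimono_le_1) auto
    have "(\<Sum>n\<in>insert x S. (1 - Q n) * ?T (insert x S) n)
        = (1 - Q x) * (\<Prod>k\<in>S. Q k) + (\<Sum>n\<in>S. (1 - Q n) * ?T (insert x S) n)"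
      using False insert.hyps(1) by (subst sum.insert) (auto simp only: eq)
    also have "(\<Sum>n\<in>S. (1 - Q n) * ?T (insert x S) n) \<le> (\<Sum>n\<in>S. (1 - Q n) * ?T S n)"
      using insert.prems le by (intro sum_mono mult_left_mono) auto
    also have "\<dots> \<le> 1 - (\<Prod>k\<in>S. Q k)"
      using insert.IH insert.prems by auto
    finally show ?thesis
      using False insert.hyps(1) by (simp add: algebra_simps)
  qed
qed

section \<open>Locally uniform convergence of products and series\<close>

text \<open>On |w| \<le> r < 1 the majorants are at most \<open>M k / (1 - r)\<close>, so the
  Weierstrass test applies there, and locally uniform limits of holomorphic functions are
  holomorphic. Describing \<open>P\<close> as a limit of partial products admits factors with
  zeros.\<close>

lemma holomorphic_infinite_product:
  fixes p :: "nat \<Rightarrow> complex \<Rightarrow> complex"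
  assumes hol: "\<And>k. p k holomorphic_on unit_disc"
    and bound: "\<And>k w. w \<in> unit_disc \<Longrightarrow> norm (p k w - 1) \<le> M k / (1 - norm w)"
    and M: "summable M"
  obtains P where "P holomorphic_on unit_disc"
    and "\<And>w. w \<in> unit_disc \<Longrightarrow> (\<lambda>m. \<Prod>k<m. p k w) \<longlonglongrightarrow> P w"
proof
  let ?P = "\<lambda>w. lim (\<lambda>m. \<Prod>k<m. p k w)"
  \<comment> \<open>The bound at w = 0 forces \<open>M k\<close> to be nonnegative, which lets 1 -
    |w| be replaced by the smaller 1 - r.\<close>
  have M0: "0 \<le> M k" for k
    using bound[of 0 k] norm_ge_zero[of "p k 0 - 1"] by (simp del: norm_ge_zero)
  have unif: "uniform_limit (cball 0 r) (\<lambda>m w. \<Prod>k<m. p k w) ?P sequentially" if r: "r < 1" for r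
  proof -
    have sub: "cball 0 r \<subseteq> unit_disc" using r by auto
    have "uniformly_convergent_on (cball 0 r) (\<lambda>m w. \<Prod>k<m. p k w)"
    proof (rule uniformly_convergent_on_prod')
      show "continuous_on (cball 0 r) (p k)" for k
        using hol sub by (blast intro: holomorphic_on_imp_continuous_on holomorphic_on_subset)
      show "uniformly_convergent_on (cball 0 r) (\<lambda>m w. \<Sum>k<m. norm (p k w - 1))"
      proof (rule Weierstrass_m_test')
        show "summable (\<lambda>k. M k / (1 - r))" using M by (rule summable_divide)
        show "norm (norm (p k w - 1)) \<le> M k / (1 - r)" if w: "w \<in> cball 0 r" for k w
        proof -
          have "norm (p k w - 1) \<le> M k / (1 - norm w)" using bound w sub by blast
          also have "\<dots> \<le> M k / (1 - r)"
            using w r M0 by (intro divide_left_mono) auto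
          finally show ?thesis by simp
        qed
      qed
    qed auto
    then show ?thesis by (simp add: uniformly_convergent_uniform_limit_iff)
  qed
  show "(\<lambda>m. \<Prod>k<m. p k w) \<longlonglongrightarrow> ?P w" if "w \<in> unit_disc" for w
    using tendsto_uniform_limitI[OF unif[of "norm w"], of w] that by auto
  show "?P holomorphic_on unit_disc"
  proof (rule holomorphic_uniform_sequence[of _ "\<lambda>m w. \<Prod>k<m. p k w"])
    fix x :: complex assume x: "x \<in> unit_disc"
    \<comment> \<open>Half the distance to the circle: the disc about \<open>x\<close> stays within
      radius (1 + |x|)/2 < 1.\<close>
    let ?d = "(1 - norm x) / 2"
    have "cball x ?d \<subseteq> cball 0 ((1 + norm x) / 2)"
      by (simp add: cball_subset_cball_iff field_simps)
    moreover have "cball 0 ((1 + norm x) / 2) \<subseteq> unit_disc" using x by auto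
    moreover have "uniform_limit (cball 0 ((1 + norm x) / 2)) (\<lambda>m w. \<Prod>k<m. p k w) ?P sequentially"
      using x by (intro unif) auto
    ultimately show "\<exists>d>0. cball x d \<subseteq> unit_disc \<and>
        uniform_limit (cball x d) (\<lambda>m w. \<Prod>k<m. p k w) ?P sequentially"
      using x by (intro exI[of _ ?d]) (auto intro: uniform_limit_on_subset)
  qed (auto intro!: holomorphic_intros hol)
qed

text \<open>The series analogue, with uniform convergence along the net of finite subsets of
  \<open>A\<close>. Holomorphy is obtained on each disc of radius r < 1, and these exhaust the unit
  disc.\<close>

lemma holomorphic_infsum:
  fixes f :: "'a \<Rightarrow> complex \<Rightarrow> complex"
  assumes hol: "\<And>n. n \<in> A \<Longrightarrow> f n holomorphic_on unit_disc"
    and bound: "\<And>n w. n \<in> A \<Longrightarrow> w \<in> unit_disc \<Longrightarrow> norm (f n w) \<le> M n / (1 - norm w)"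
    and M: "M summable_on A"
  shows "(\<lambda>w. \<Sum>\<^sub>\<infinity>n\<in>A. f n w) holomorphic_on unit_disc"
proof -
  have M0: "0 \<le> M n" if "n \<in> A" for n
    using bound[OF that, of 0] norm_ge_zero[of "f n 0"] by (simp del: norm_ge_zero)
  have "(\<lambda>w. \<Sum>\<^sub>\<infinity>n\<in>A. f n w) holomorphic_on ball 0 r" if r: "r < 1" for r :: real
  proof -
    have sub: "cball 0 r \<subseteq> unit_disc" "ball 0 r \<subseteq> unit_disc" using r by auto
    have "uniform_limit (cball 0 r) (\<lambda>F w. \<Sum>n\<in>F. f n w) (\<lambda>w. \<Sum>\<^sub>\<infinity>n\<in>A. f n w)
            (finite_subsets_at_top A)"
    proof (rule Weierstrass_m_test_general)
      show "(\<lambda>n. M n / (1 - r)) summable_on A"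
        using summable_on_cmult_right[OF M, of "1 / (1 - r)"] by simp
      show "norm (f n w) \<le> M n / (1 - r)" if "n \<in> A" "w \<in> cball 0 r" for n w
      proof -
        have "norm (f n w) \<le> M n / (1 - norm w)" using bound that sub by blast
        also have "\<dots> \<le> M n / (1 - r)"
          using that r M0 by (intro divide_left_mono) auto
        finally show ?thesis .
      qed
    qed
    moreover have "eventually (\<lambda>F. continuous_on (cball 0 r) (\<lambda>w. \<Sum>n\<in>F. f n w) \<and>
        (\<lambda>w. \<Sum>n\<in>F. f n w) holomorphic_on ball 0 r) (finite_subsets_at_top A)"
    proof (rule eventually_finite_subsets_at_top_weakI)
      fix F assume F: "F \<subseteq> A"
      have "(\<lambda>w. \<Sum>n\<in>F. f n w) holomorphic_on unit_disc"
        using F hol by (intro holomorphic_intros) auto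
      then show "continuous_on (cball 0 r) (\<lambda>w. \<Sum>n\<in>F. f n w) \<and>
          (\<lambda>w. \<Sum>n\<in>F. f n w) holomorphic_on ball 0 r"
        using sub by (blast intro: holomorphic_on_imp_continuous_on holomorphic_on_subset)
    qed
    ultimately show ?thesis
      by (auto elim: holomorphic_uniform_limit[rotated])
  qed
  then have "(\<lambda>w. \<Sum>\<^sub>\<infinity>n\<in>A. f n w) holomorphic_on (\<Union>r\<in>{..<1}. ball 0 r)"
    by (intro holomorphic_on_UN_open) auto
  moreover have "unit_disc \<subseteq> (\<Union>r\<in>{..<1}. ball (0::complex) r)"
    using dense by fastforce
  ultimately show ?thesis
    by (rule holomorphic_on_subset)
qed

section \<open>Thin sequences\<close>

lemma thin_seq_disc: "thin_seq z \<Longrightarrow> 1 \<le> j \<Longrightarrow> z j \<in> unit_disc"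
  by (simp add: thin_seq_def)

text \<open>The partial products decrease and are nonnegative, so the \<open>lim\<close> in
  \<open>sep_prod\<close> is a genuine limit.\<close>

lemma sep_prod_le_partial_prod:
  assumes disc: "\<And>k. 1 \<le> k \<Longrightarrow> z k \<in> unit_disc" and "1 \<le> j"
  shows "sep_prod z j \<le> (\<Prod>k\<in>{1..m} - {j}. pseudo_hyp (z j) (z k))"
proof -
  let ?P = "\<lambda>m. \<Prod>k\<in>{1..m} - {j}. pseudo_hyp (z j) (z k)"
  have rho: "0 \<le> pseudo_hyp (z j) (z k) \<and> pseudo_hyp (z j) (z k) \<le> 1" if "1 \<le> k" for k
    using that assms by (auto intro: pseudo_hyp_le_1 pseudo_hyp_nonneg)
  have dec: "decseq ?P"
    unfolding decseq_def by (intro allI impI prod_antimono_le_1) (auto simp: rho)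
  moreover have "0 \<le> ?P m" for m
    by (intro prod_nonneg) (auto simp: rho)
  ultimately obtain L where "?P \<longlonglongrightarrow> L"
    using decseq_convergent[of ?P 0] by metis
  then have "?P \<longlonglongrightarrow> sep_prod z j"
    by (simp add: sep_prod_def limI)
  with dec show ?thesis
    by (rule decseq_ge)
qed

text \<open>From \<rho> \<le> exp(\<rho> - 1), the sum of 1 - \<rho> is at most -ln of the product;
  the factor 2 comes from 1 - \<rho>^2 \<le> 2(1 - \<rho>). A separation product near 1 thus makes
  the sum small.\<close>

lemma sum_one_minus_pseudo_hyp_sq_le:
  assumes disc: "\<And>k. 1 \<le> k \<Longrightarrow> z k \<in> unit_disc" and "1 \<le> j" and pos: "0 < sep_prod z j"
    and K: "finite K" "K \<subseteq> {1..} - {j}"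
  shows "(\<Sum>k\<in>K. 1 - (pseudo_hyp (z j) (z k))\<^sup>2) \<le> - 2 * ln (sep_prod z j)"
proof -
  let ?\<rho> = "\<lambda>k. pseudo_hyp (z j) (z k)"
  have rho: "0 \<le> ?\<rho> k" "?\<rho> k \<le> 1" if "1 \<le> k" for k
    using that assms by (auto intro: pseudo_hyp_le_1 pseudo_hyp_nonneg)
  obtain m where m: "K \<subseteq> {..m}"
    using K(1) finite_nat_iff_bounded_le by blast
  let ?A = "{1..m} - {j}"
  have KA: "K \<subseteq> ?A" using m K by auto
  have "sep_prod z j \<le> (\<Prod>k\<in>?A. ?\<rho> k)"
    using disc \<open>1 \<le> j\<close> by (rule sep_prod_le_partial_prod)
  also have "\<dots> \<le> (\<Prod>k\<in>?A. exp (?\<rho> k - 1))"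
    using exp_ge_add_one_self[of "?\<rho> _ - 1"] rho by (intro prod_mono) auto
  also have "\<dots> = exp (\<Sum>k\<in>?A. ?\<rho> k - 1)"
    by (simp add: exp_sum)
  finally have "ln (sep_prod z j) \<le> (\<Sum>k\<in>?A. ?\<rho> k - 1)"
    using pos by (subst (asm) ln_le_cancel_iff[symmetric]) auto
  then have "2 * (\<Sum>k\<in>?A. 1 - ?\<rho> k) \<le> - 2 * ln (sep_prod z j)"
    by (simp add: sum_subtractf)
  moreover have "(\<Sum>k\<in>K. 1 - (?\<rho> k)\<^sup>2) \<le> (\<Sum>k\<in>?A. 1 - (?\<rho> k)\<^sup>2)"
    using KA rho by (intro sum_mono2) (auto simp: abs_square_le_1)
  moreover have "(\<Sum>k\<in>?A. 1 - (?\<rho> k)\<^sup>2) \<le> (\<Sum>k\<in>?A. 2 * (1 - ?\<rho> k))"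
  proof (rule sum_mono)
    fix k assume "k \<in> ?A"
    have "0 \<le> (1 - ?\<rho> k)\<^sup>2" by simp
    then show "1 - (?\<rho> k)\<^sup>2 \<le> 2 * (1 - ?\<rho> k)"
      by (simp add: power2_eq_square algebra_simps)
  qed
  ultimately show ?thesis
    by (simp add: sum_distrib_left)
qed

text \<open>Fix one j with positive separation product: the terms 1 - \<rho>(z_j, z_k)^2 have
  bounded sums and dominate a fixed multiple of 1 - |z_k|^2. The shift by \<open>Suc\<close> skips
  \<open>z 0\<close>, which is not assumed to lie in the disc.\<close>

lemma thin_seq_Blaschke:
  assumes thin: "thin_seq z"
  shows "summable (\<lambda>k. 1 - (norm (z (Suc k)))\<^sup>2)"
proof -
  note disc = thin_seq_disc[OF thin]
  have "eventually (\<lambda>j. 0 < sep_prod z j) sequentially"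
    using thin by (intro order_tendstoD) (auto simp: thin_seq_def)
  then obtain j where j: "1 \<le> j" "0 < sep_prod z j"
    by (metis eventually_sequentially nle_le)
  \<comment> \<open>The 4 is the bound 2^2 for the squared denominator of \<rho>(z_j, z_k).\<close>
  define d where "d = (1 - (norm (z j))\<^sup>2) / 4"
  have d: "0 < d"
    using disc[OF j(1)] by (simp add: d_def abs_square_less_1)
  have nonneg: "0 \<le> 1 - (norm (z k))\<^sup>2" if "1 \<le> k" for k
    using disc[OF that] by (simp add: norm_sq_le_1)
  have single: "d * (1 - (norm (z k))\<^sup>2) \<le> 1 - (pseudo_hyp (z j) (z k))\<^sup>2" if k: "1 \<le> k" for k
  proof -
    have "norm (1 - cnj (z k) * z j) \<le> norm (1::complex) + norm (cnj (z k) * z j)"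
      by (rule norm_triangle_ineq4)
    also have "norm (cnj (z k) * z j) \<le> 1"
      using disc[OF j(1)] disc[OF k] by (simp add: norm_mult mult_le_one)
    finally have "(norm (1 - cnj (z k) * z j))\<^sup>2 \<le> 2\<^sup>2"
      by (intro power_mono) auto
    then have "(1 - (norm (z k))\<^sup>2) * (1 - (norm (z j))\<^sup>2) / 4
        \<le> (1 - (norm (z k))\<^sup>2) * (1 - (norm (z j))\<^sup>2) / (norm (1 - cnj (z k) * z j))\<^sup>2"
      using nonneg[OF k] nonneg[OF j(1)] one_minus_cnj_mult_nonzero[OF disc[OF k] disc[OF j(1)]]
      by (intro divide_left_mono mult_pos_pos) auto
    then show ?thesis
      by (simp add: one_minus_pseudo_hyp_sq[OF disc[OF k] disc[OF j(1)]] d_def mult_ac)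
  qed
  \<comment> \<open>The leading 1 covers the term k = j, which the separation sum omits.\<close>
  have "(\<Sum>k<n. 1 - (norm (z (Suc k)))\<^sup>2) \<le> 1 + - 2 * ln (sep_prod z j) / d" for n
  proof -
    have "(\<Sum>k<n. 1 - (norm (z (Suc k)))\<^sup>2) = (\<Sum>k\<in>{1..n}. 1 - (norm (z k))\<^sup>2)"
      by (rule sum.reindex_bij_witness[of _ "\<lambda>k. k - 1" Suc]) auto
    also have "\<dots> \<le> (\<Sum>k\<in>insert j ({1..n} - {j}). 1 - (norm (z k))\<^sup>2)"
      using nonneg j by (intro sum_mono2) auto
    also have "\<dots> = (1 - (norm (z j))\<^sup>2) + (\<Sum>k\<in>{1..n} - {j}. 1 - (norm (z k))\<^sup>2)"
      by (subst sum.insert) auto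
    also have "(\<Sum>k\<in>{1..n} - {j}. 1 - (norm (z k))\<^sup>2) \<le> - 2 * ln (sep_prod z j) / d"
    proof -
      have "d * (\<Sum>k\<in>{1..n} - {j}. 1 - (norm (z k))\<^sup>2)
          \<le> (\<Sum>k\<in>{1..n} - {j}. 1 - (pseudo_hyp (z j) (z k))\<^sup>2)"
        unfolding sum_distrib_left by (intro sum_mono single) auto
      also have "\<dots> \<le> - 2 * ln (sep_prod z j)"
        using disc j by (intro sum_one_minus_pseudo_hyp_sq_le) auto
      finally show ?thesis using d by (simp add: field_simps)
    qed
    finally show ?thesis
      using zero_le_power2[of "norm (z j)"] by linarith
  qed
  then show ?thesis
    by (intro summableI_nonneg_bounded[where x = "1 + - 2 * ln (sep_prod z j) / d"] nonneg) auto
qed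

text \<open>Thinness sends -2 ln \<open>sep_prod z n\<close> to 0, which handles the separation
  sums; the radii form a tail of the convergent Blaschke sum.\<close>

lemma thin_seq_tail_small:
  assumes thin: "thin_seq z" and \<theta>: "0 < \<theta>"
  obtains N where "1 \<le> N"
    and "\<And>K. finite K \<Longrightarrow> K \<subseteq> {N..} \<Longrightarrow> (\<Sum>k\<in>K. 1 - (norm (z k))\<^sup>2) \<le> \<theta>"
    and "\<And>n K. N \<le> n \<Longrightarrow> finite K \<Longrightarrow> K \<subseteq> {N..} - {n} \<Longrightarrow>
           (\<Sum>k\<in>K. 1 - (pseudo_hyp (z n) (z k))\<^sup>2) \<le> \<theta>"
proof -
  note disc = thin_seq_disc[OF thin]
  have lim: "sep_prod z \<longlonglongrightarrow> 1"
    using thin by (simp add: thin_seq_def)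
  have "(\<lambda>n. - 2 * ln (sep_prod z n)) \<longlonglongrightarrow> - 2 * ln 1"
    by (intro tendsto_intros lim) auto
  then have "eventually (\<lambda>n. - 2 * ln (sep_prod z n) < \<theta>) sequentially"
    using \<theta> by (intro order_tendstoD(2)) auto
  moreover have "eventually (\<lambda>n. 0 < sep_prod z n) sequentially"
    using lim by (rule order_tendstoD) simp
  ultimately have "eventually (\<lambda>n. - 2 * ln (sep_prod z n) < \<theta> \<and> 0 < sep_prod z n) sequentially"
    by (rule eventually_conj)
  then obtain N1 where N1: "\<And>n. N1 \<le> n \<Longrightarrow> - 2 * ln (sep_prod z n) < \<theta> \<and> 0 < sep_prod z n"
    by (auto simp: eventually_sequentially)
  obtain N2 where N2: "\<And>m. N2 \<le> m \<Longrightarrow> norm (\<Sum>i. 1 - (norm (z (Suc (i + m))))\<^sup>2) < \<theta>"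
    using suminf_exist_split[OF \<theta> thin_seq_Blaschke[OF thin]] by blast
  \<comment> \<open>\<open>Suc\<close> makes \<open>N\<close> at least 1 and aligns k = i + N with
    the index \<open>Suc (i + max N1 N2)\<close> of the Blaschke tail.\<close>
  define N where "N = Suc (max N1 N2)"
  show ?thesis
  proof
    show "1 \<le> N" by (simp add: N_def)
  next
    fix K assume K: "finite K" "K \<subseteq> {N..}"
    let ?M = "\<lambda>i. 1 - (norm (z (Suc (i + max N1 N2))))\<^sup>2"
    have "summable ?M"
      using summable_ignore_initial_segment[OF thin_seq_Blaschke[OF thin], of "max N1 N2"] .
    have "(\<Sum>k\<in>K. 1 - (norm (z k))\<^sup>2) = (\<Sum>i\<in>(\<lambda>k. k - N) ` K. ?M i)"
      by (rule sum.reindex_bij_witness[of _ "\<lambda>i. i + N" "\<lambda>k. k - N"]) (use K in \<open>auto simp: N_def\<close>)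
    also have "\<dots> \<le> suminf ?M"
      using K disc \<open>summable ?M\<close> by (intro sum_le_suminf) (auto simp: norm_sq_le_1)
    also have "\<dots> \<le> \<theta>"
      using N2[of "max N1 N2"] by simp
    finally show "(\<Sum>k\<in>K. 1 - (norm (z k))\<^sup>2) \<le> \<theta>" .
  next
    fix n K assume n: "N \<le> n" and K: "finite K" "K \<subseteq> {N..} - {n}"
    have "(\<Sum>k\<in>K. 1 - (pseudo_hyp (z n) (z k))\<^sup>2) \<le> - 2 * ln (sep_prod z n)"
      using N1[of n] n K by (intro sum_one_minus_pseudo_hyp_sq_le disc) (auto simp: N_def)
    also have "\<dots> \<le> \<theta>"
      using N1[of n] n unfolding N_def by linarith
    finally show "(\<Sum>k\<in>K. 1 - (pseudo_hyp (z n) (z k))\<^sup>2) \<le> \<theta>" .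
  qed
qed

section \<open>Interpolation\<close>

text \<open>These are the functions before normalisation. In the lower bound, \<beta>/(\<beta> + 1)
  is the peak value at the node, (1 - \<theta>)^2 accounts for the products of |z_k| and of
  \<rho>(z_n, z_k), and 1 - 3c\<theta> for the exponentials. The final bound serves locally uniform
  convergence of series in \<open>h n\<close>.\<close>

lemma interpolating_family:
  fixes z :: "nat \<Rightarrow> complex" and N :: nat and \<beta> \<theta> :: real
  defines "c \<equiv> \<beta> * (\<beta> + 1)"
  assumes disc: "\<And>k. N \<le> k \<Longrightarrow> z k \<in> unit_disc" and \<beta>: "0 \<le> \<beta>"
    and \<theta>: "0 \<le> \<theta>" "\<theta> \<le> 1" "3 * c * \<theta> \<le> 1"
    and radii: "\<And>K. finite K \<Longrightarrow> K \<subseteq> {N..} \<Longrightarrow> (\<Sum>k\<in>K. 1 - (norm (z k))\<^sup>2) \<le> \<theta>"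
    and separation: "\<And>n K. N \<le> n \<Longrightarrow> finite K \<Longrightarrow> K \<subseteq> {N..} - {n} \<Longrightarrow>
           (\<Sum>k\<in>K. 1 - (pseudo_hyp (z n) (z k))\<^sup>2) \<le> \<theta>"
  obtains h :: "nat \<Rightarrow> complex \<Rightarrow> complex" where
    "\<And>n. N \<le> n \<Longrightarrow> h n holomorphic_on unit_disc"
    "\<And>n k. N \<le> n \<Longrightarrow> N \<le> k \<Longrightarrow> k \<noteq> n \<Longrightarrow> h n (z k) = 0"
    "\<And>n. N \<le> n \<Longrightarrow> \<beta> / (\<beta> + 1) * ((1 - \<theta>)\<^sup>2 * (1 - 3 * c * \<theta>)) \<le> norm (h n (z n))"
    "\<And>F w. w \<in> unit_disc \<Longrightarrow> finite F \<Longrightarrow> F \<subseteq> {N..} \<Longrightarrow> (\<Sum>n\<in>F. norm (h n w)) \<le> 1"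
    "\<And>n w. N \<le> n \<Longrightarrow> w \<in> unit_disc \<Longrightarrow>
       norm (h n w) \<le> 2 * c * (1 - (norm (z n))\<^sup>2) / (1 - norm w)"
proof -
  define s where "s k w = disc_kernel (z k) w" for k w
  \<comment> \<open>Damping is restricted to |z_k| \<ge> |z_n|, where
    \<open>twice_Re_disc_kernel_le\<close> controls its cost at z_n; these are also the factors that
    \<open>sum_weights_prod_le\<close> asks for.\<close>
  define \<gamma> where "\<gamma> n k = (if norm (z n) \<le> norm (z k) then 2 * c else 0)" for n k
  define q where "q n k w = (1 - s k w) * exp (- (of_real (\<gamma> n k) * s k w))" for n k w
  \<comment> \<open>Setting the factor to 1 for k < N and k = n lets the product run over all
    k.\<close>
  define p where "p n k w = (if N \<le> k \<and> k \<noteq> n then q n k w else 1)" for n k w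
  define M where "M k = (if N \<le> k then (1 + 2 * c) * (1 - (norm (z k))\<^sup>2) else 0)" for k
  have c: "0 \<le> c" using \<beta> by (simp add: c_def)
  have \<gamma>: "0 \<le> \<gamma> n k" "\<gamma> n k \<le> 2 * c" for n k using c by (auto simp: \<gamma>_def)
  have s: "norm (1 - s k w) \<le> 1" if "N \<le> k" "w \<in> unit_disc" for k w
    unfolding s_def using that disc by (intro norm_one_minus_disc_kernel_le_1)
  have s_hol: "s k holomorphic_on unit_disc" if "N \<le> k" for k
    unfolding s_def using that disc holomorphic_disc_kernel by simp
  have norm_s: "norm (s k w) \<le> (1 - (norm (z k))\<^sup>2) / (1 - norm w)" if "N \<le> k" "w \<in> unit_disc" for k w
    unfolding s_def using that disc by (intro norm_disc_kernel_le)
  have norm_q: "norm (q n k w) = norm (1 - s k w) * exp (- (\<gamma> n k * Re (s k w)))" for n k w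
    by (simp add: q_def norm_mult)
  have q1: "norm (q n k w) \<le> exp (- (\<gamma> n k * Re (s k w)))" if "N \<le> k" "w \<in> unit_disc" for n k w
    unfolding norm_q using s[OF that] by (intro mult_left_le_one_le) auto
  have Re_s: "0 \<le> Re (s k w)" if "N \<le> k" "w \<in> unit_disc" for k w
    by (rule norm_sq_le_twice_Re(2)[OF s[OF that]])
  have p1: "norm (p n k w) \<le> 1" if "w \<in> unit_disc" for n k w
    using order_trans[OF q1[of k w n], of 1] Re_s[of k w] \<gamma>(1)[of n k] that by (auto simp: p_def)

  have "\<exists>P. P holomorphic_on unit_disc \<and>
          (\<forall>w\<in>unit_disc. (\<lambda>m. \<Prod>k<m. p n k w) \<longlonglongrightarrow> P w)" for n
  proof (rule holomorphic_infinite_product[of "p n" M])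
    show "p n k holomorphic_on unit_disc" for k
      unfolding p_def q_def by (cases "N \<le> k \<and> k \<noteq> n") (auto intro!: holomorphic_intros s_hol)
    show "norm (p n k w - 1) \<le> M k / (1 - norm w)" if w: "w \<in> unit_disc" for k w
    proof (cases "N \<le> k \<and> k \<noteq> n")
      case True
      have "norm (p n k w - 1) \<le> (1 + \<gamma> n k) * norm (s k w)"
        using True w s \<gamma> unfolding p_def q_def by (auto intro!: norm_damped_factor_minus_one_le)
      also have "\<dots> \<le> (1 + 2 * c) * ((1 - (norm (z k))\<^sup>2) / (1 - norm w))"
        using True w \<gamma>[of n k] c norm_s by (intro mult_mono) auto
      finally show ?thesis using True by (simp add: M_def)
    next
      case False
      then show ?thesis
        using w c norm_sq_le_1[OF disc[of k]] by (auto simp: p_def M_def)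
    qed
    show "summable M"
    proof (rule summableI_nonneg_bounded)
      show "0 \<le> M k" for k
        using c norm_sq_le_1[OF disc[of k]] by (auto simp: M_def)
      fix m
      have "(\<Sum>k<m. M k) = (\<Sum>k\<in>{N..<m}. (1 + 2 * c) * (1 - (norm (z k))\<^sup>2))"
        by (rule sum.mono_neutral_cong_right) (auto simp: M_def)
      also have "\<dots> = (1 + 2 * c) * (\<Sum>k\<in>{N..<m}. 1 - (norm (z k))\<^sup>2)"
        by (simp add: sum_distrib_left)
      also have "\<dots> \<le> (1 + 2 * c) * \<theta>"
        using c by (intro mult_left_mono radii) auto
      finally show "(\<Sum>k<m. M k) \<le> (1 + 2 * c) * \<theta>" .
    qed
  qed blast
  then obtain P where P_hol: "\<And>n. P n holomorphic_on unit_disc"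
    and P_lim: "\<And>n w. w \<in> unit_disc \<Longrightarrow> (\<lambda>m. \<Prod>k<m. p n k w) \<longlonglongrightarrow> P n w"
    by metis
  \<comment> \<open>All factors have modulus at most 1, so every finite subproduct bounds |P n|.
    This is used with A = {k} for the zeros, A = {} for |P n| \<le> 1, and the damped factors for
    the sum.\<close>
  have P_le: "norm (P n w) \<le> (\<Prod>k\<in>A. norm (p n k w))" if w: "w \<in> unit_disc" and "finite A" for n w A
  proof (rule Lim_norm_ubound[OF _ P_lim[OF w]])
    obtain m0 where m0: "A \<subseteq> {..<m0}"
      using \<open>finite A\<close> finite_nat_iff_bounded by blast
    have "norm (\<Prod>k<m. p n k w) \<le> (\<Prod>k\<in>A. norm (p n k w))" if "m0 \<le> m" for m
      unfolding prod_norm[symmetric] using m0 that p1[OF w] by (intro prod_antimono_le_1) auto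
    then show "eventually (\<lambda>m. norm (\<Prod>k<m. p n k w) \<le> (\<Prod>k\<in>A. norm (p n k w))) sequentially"
      by (auto simp: eventually_sequentially)
  qed simp

  define h where "h n w = peak \<beta> (s n w) * P n w" for n w
  have peak: "norm (peak \<beta> (s n w)) \<le> 1 - exp (- (2 * c * Re (s n w)))"
    if "N \<le> n" "w \<in> unit_disc" for n w
    unfolding c_def using \<beta> s[OF that] by (rule norm_peak_le)

  have hol: "h n holomorphic_on unit_disc" if n: "N \<le> n" for n
  proof -
    have "1 + of_real \<beta> * s n w \<noteq> 0" if "w \<in> unit_disc" for w
      using peak_denominator_ge[OF \<beta> Re_s[OF n that]] by auto
    then show ?thesis
      unfolding h_def peak_def by (auto intro!: holomorphic_intros s_hol[OF n] P_hol)
  qed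

  have zero: "h n (z k) = 0" if "N \<le> n" "N \<le> k" "k \<noteq> n" for n k
  proof -
    have "p n k (z k) = 0"
      using that disc by (simp add: p_def q_def s_def disc_kernel_self)
    then show ?thesis
      using P_le[OF disc, of k "{k}" n] that by (simp add: h_def)
  qed

  have sum_le: "(\<Sum>n\<in>F. norm (h n w)) \<le> 1" if w: "w \<in> unit_disc" and F: "finite F" "F \<subseteq> {N..}" for F w
  proof -
    \<comment> \<open>The modulus of the damping exponential at \<open>k\<close>. Since the peak at
      \<open>n\<close> is at most 1 - Q n, these are the weights of
      \<open>sum_weights_prod_le\<close>, ranked by |z_k|.\<close>
    define Q where "Q k = exp (- (2 * c * Re (s k w)))" for k
    have Q: "0 \<le> Q k \<and> Q k \<le> 1" if "k \<in> F" for k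
      using that F w c Re_s[of k w] by (auto simp: Q_def)
    have "norm (h n w) \<le> (1 - Q n) * (\<Prod>k\<in>{k\<in>F. k \<noteq> n \<and> norm (z n) \<le> norm (z k)}. Q k)"
      if n: "n \<in> F" for n
    proof -
      have "norm (P n w) \<le> (\<Prod>k\<in>{k\<in>F. k \<noteq> n \<and> norm (z n) \<le> norm (z k)}. norm (p n k w))"
        using F by (intro P_le[OF w]) auto
      also have "\<dots> \<le> (\<Prod>k\<in>{k\<in>F. k \<noteq> n \<and> norm (z n) \<le> norm (z k)}. Q k)"
      proof (intro prod_mono conjI norm_ge_zero)
        fix k assume k: "k \<in> {k\<in>F. k \<noteq> n \<and> norm (z n) \<le> norm (z k)}"
        then show "norm (p n k w) \<le> Q k"
          using q1[of k w n] w F by (auto simp: p_def Q_def \<gamma>_def)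
      qed
      finally show ?thesis
        unfolding h_def norm_mult using peak[of n w] Q[OF n] n F w
        by (intro mult_mono) (auto simp: Q_def)
    qed
    then have "(\<Sum>n\<in>F. norm (h n w)) \<le>
        (\<Sum>n\<in>F. (1 - Q n) * (\<Prod>k\<in>{k\<in>F. k \<noteq> n \<and> norm (z n) \<le> norm (z k)}. Q k))"
      by (intro sum_mono)
    also have "\<dots> \<le> 1 - (\<Prod>k\<in>F. Q k)"
      using F(1) Q by (rule sum_weights_prod_le)
    also have "\<dots> \<le> 1"
      using Q by (simp add: prod_nonneg)
    finally show ?thesis .
  qed

  have bound: "norm (h n w) \<le> 2 * c * (1 - (norm (z n))\<^sup>2) / (1 - norm w)"
    if n: "N \<le> n" and w: "w \<in> unit_disc" for n w
  proof -
    have "norm (h n w) \<le> norm (peak \<beta> (s n w))"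
      unfolding h_def norm_mult using P_le[OF w, of "{}" n] by (intro mult_left_le) auto
    also have "\<dots> \<le> 2 * c * norm (s n w)"
      unfolding c_def using \<beta> s[OF n w] by (rule norm_peak_le_norm)
    also have "\<dots> \<le> 2 * c * ((1 - (norm (z n))\<^sup>2) / (1 - norm w))"
      using c norm_s[OF n w] by (intro mult_left_mono) auto
    finally show ?thesis by simp
  qed

  have lower: "\<beta> / (\<beta> + 1) * ((1 - \<theta>)\<^sup>2 * (1 - 3 * c * \<theta>)) \<le> norm (h n (z n))" if n: "N \<le> n" for n
  proof -
    let ?\<rho> = "\<lambda>k. pseudo_hyp (z n) (z k)"
    \<comment> \<open>An upper bound for the exponent \<gamma> Re s at z_n: by the kernel estimate
      where damping is present, and by nonnegativity where \<gamma> = 0.\<close>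
    let ?e = "\<lambda>k. c * ((1 - (norm (z k))\<^sup>2) + 2 * (1 - (?\<rho> k)\<^sup>2))"
    have partial: "(1 - \<theta>)\<^sup>2 * (1 - 3 * c * \<theta>) \<le> norm (\<Prod>k<m. p n k (z n))" for m
    proof -
      define K where "K = {N..<m} - {n}"
      have K: "finite K" "K \<subseteq> {N..}" "K \<subseteq> {N..} - {n}" by (auto simp: K_def)
      have r: "norm (z k) \<le> 1" "0 \<le> ?\<rho> k" "?\<rho> k \<le> 1" if "k \<in> K" for k
        using that K disc[of k] disc[OF n] by (auto intro!: pseudo_hyp_nonneg pseudo_hyp_le_1)
      have sq: "1 - x \<le> 1 - x\<^sup>2" if "0 \<le> x" "x \<le> 1" for x :: real
        using that by (simp add: power2_eq_square mult_left_le)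
      \<comment> \<open>The product of 1 - x_k is at least 1 minus the sum of x_k, here with x_k = 1
        - |z_k| \<le> 1 - |z_k|^2; the same argument follows for \<rho>.\<close>
      have "1 - \<theta> \<le> 1 - (\<Sum>k\<in>K. 1 - norm (z k))"
        using radii[OF K(1,2)] sum_mono[of K "\<lambda>k. 1 - norm (z k)" "\<lambda>k. 1 - (norm (z k))\<^sup>2"] r sq
        by fastforce
      also have "\<dots> \<le> (\<Prod>k\<in>K. 1 - (1 - norm (z k)))"
        using r by (intro Weierstrass_prod_ineq) auto
      finally have A: "1 - \<theta> \<le> (\<Prod>k\<in>K. norm (z k))" by simp
      have "1 - \<theta> \<le> 1 - (\<Sum>k\<in>K. 1 - ?\<rho> k)"
        using separation[OF n K(1,3)] sum_mono[of K "\<lambda>k. 1 - ?\<rho> k" "\<lambda>k. 1 - (?\<rho> k)\<^sup>2"] r sq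
        by fastforce
      also have "\<dots> \<le> (\<Prod>k\<in>K. 1 - (1 - ?\<rho> k))"
        using r by (intro Weierstrass_prod_ineq) auto
      finally have B: "1 - \<theta> \<le> (\<Prod>k\<in>K. ?\<rho> k)" by simp
      have "(\<Sum>k\<in>K. ?e k) = c * ((\<Sum>k\<in>K. 1 - (norm (z k))\<^sup>2) + 2 * (\<Sum>k\<in>K. 1 - (?\<rho> k)\<^sup>2))"
        by (simp only: sum.distrib flip: sum_distrib_left)
      \<comment> \<open>One \<theta> comes from the radii and two from the separation sum; hence the
        3.\<close>
      also have "\<dots> \<le> c * (\<theta> + 2 * \<theta>)"
        using radii[OF K(1,2)] separation[OF n K(1,3)] c by (intro mult_left_mono add_mono) auto
      finally have "1 - 3 * c * \<theta> \<le> 1 + (- (\<Sum>k\<in>K. ?e k))" by simp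
      also have "\<dots> \<le> exp (- (\<Sum>k\<in>K. ?e k))"
        by (rule exp_ge_add_one_self)
      also have "\<dots> = (\<Prod>k\<in>K. exp (- ?e k))"
        using K(1) by (simp only: exp_sum flip: sum_negf)
      finally have C: "1 - 3 * c * \<theta> \<le> (\<Prod>k\<in>K. exp (- ?e k))" .
      have "(1 - \<theta>)\<^sup>2 * (1 - 3 * c * \<theta>) = (1 - \<theta>) * (1 - \<theta>) * (1 - 3 * c * \<theta>)"
        by (simp add: power2_eq_square)
      \<comment> \<open>The conditions \<theta> \<le> 1 and 3c\<theta> \<le> 1 keep the lower bounds
        nonnegative, so they may be multiplied.\<close>
      also have "\<dots> \<le> (\<Prod>k\<in>K. norm (z k)) * (\<Prod>k\<in>K. ?\<rho> k) * (\<Prod>k\<in>K. exp (- ?e k))"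
        using A B C \<theta> r by (intro mult_mono mult_nonneg_nonneg prod_nonneg) auto
      also have "\<dots> = (\<Prod>k\<in>K. norm (z k) * ?\<rho> k * exp (- ?e k))"
        by (simp only: prod.distrib)
      also have "\<dots> \<le> (\<Prod>k\<in>K. norm (p n k (z n)))"
      proof (intro prod_mono conjI)
        fix k assume k: "k \<in> K"
        then have k': "N \<le> k" "k \<noteq> n" by (auto simp: K_def)
        show "0 \<le> norm (z k) * ?\<rho> k * exp (- ?e k)"
          using r[OF k] by simp
        have "\<gamma> n k * Re (s k (z n)) \<le> ?e k"
        proof (cases "norm (z n) \<le> norm (z k)")
          case True
          have "c * (2 * Re (s k (z n))) \<le> ?e k"
            unfolding s_def using True k' n disc c
            by (intro mult_left_mono twice_Re_disc_kernel_le) auto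
          then show ?thesis using True by (simp add: \<gamma>_def mult_ac)
        next
          case False
          then show ?thesis
            using c r[OF k]
            by (auto simp: \<gamma>_def abs_square_le_1 intro!: mult_nonneg_nonneg add_nonneg_nonneg
                simp del: right_diff_distrib_numeral)
        qed
        then show "norm (z k) * ?\<rho> k * exp (- ?e k) \<le> norm (p n k (z n))"
          using k' r[OF k] norm_one_minus_disc_kernel[OF disc[OF k'(1)] disc[OF n]]
          by (simp add: p_def norm_q s_def mult_left_mono)
      qed
      also have "\<dots> = (\<Prod>k<m. norm (p n k (z n)))"
        by (rule prod.mono_neutral_left) (auto simp: K_def p_def)
      finally show ?thesis by (simp add: prod_norm)
    qed
    have "(1 - \<theta>)\<^sup>2 * (1 - 3 * c * \<theta>) \<le> norm (P n (z n))"
      using LIMSEQ_le_const[OF tendsto_norm[OF P_lim[OF disc[OF n]]]] partial by blast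
    moreover have "norm (peak \<beta> (s n (z n))) = \<beta> / (\<beta> + 1)"
    proof -
      have "peak \<beta> (s n (z n)) = of_real (\<beta> * (\<beta> + 1) / (\<beta> + 1)\<^sup>2)"
        using disc[OF n] by (simp add: peak_def s_def disc_kernel_self add.commute)
      then show ?thesis
        using \<beta> by (simp only: norm_of_real) (simp add: power2_eq_square)
    qed
    ultimately show ?thesis
      unfolding h_def norm_mult using \<beta> \<theta> by (intro mult_mono) auto
  qed
  show thesis
    using that[of h] hol zero lower sum_le bound by blast
qed

section \<open>The linear operator taking a to g_a\<close>

text \<open>The majorants \<open>M\<close> give locally uniform convergence and hence holomorphy.
  Absolute convergence and the norm estimate come from the sums of |f_n|, since |a_n| is at most the
  tail norm.\<close>

lemma interp_sum_properties:
  assumes hol: "\<And>n. N \<le> n \<Longrightarrow> f n holomorphic_on unit_disc"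
    and bound: "\<And>n w. N \<le> n \<Longrightarrow> w \<in> unit_disc \<Longrightarrow> norm (f n w) \<le> M n / (1 - norm w)"
    and M: "M summable_on {N..}"
    and summ: "\<And>w. w \<in> unit_disc \<Longrightarrow> (\<lambda>n. norm (f n w)) summable_on {N..}"
    and sum_le: "\<And>w. w \<in> unit_disc \<Longrightarrow> (\<Sum>\<^sub>\<infinity>n\<in>{N..}. norm (f n w)) \<le> C"
    and a: "bounded (a ` {N..})"
  shows "\<And>w. w \<in> unit_disc \<Longrightarrow> (\<lambda>n. a n * f n w) summable_on {N..}"
    and "interp_sum N f a \<in> Hinf"
    and "Hinf_norm (interp_sum N f a) \<le> C * linf_tail_norm N a"
proof -
  define t where "t = linf_tail_norm N a"
  have bdd: "bdd_above ((\<lambda>j. norm (a j)) ` {N..})"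
    using a by (auto simp: bounded_iff bdd_above_def)
  have a_le: "norm (a n) \<le> t" if "N \<le> n" for n
    unfolding t_def linf_tail_norm_def using that bdd by (intro cSUP_upper) auto
  have t: "0 \<le> t" using a_le[of N] norm_ge_zero[of "a N"] by linarith
  have le: "norm (a n * f n w) \<le> t * norm (f n w)" if "N \<le> n" for n w
    unfolding norm_mult using a_le[OF that] by (intro mult_right_mono) auto
  have summ_t: "(\<lambda>n. t * norm (f n w)) summable_on {N..}" if "w \<in> unit_disc" for w
    using summ[OF that] by (rule summable_on_cmult_right)
  have abs_summ: "(\<lambda>n. norm (a n * f n w)) summable_on {N..}" if w: "w \<in> unit_disc" for w
    using summ_t[OF w] le by (rule Infinite_Sum.abs_summable_on_comparison_test') auto
  show "(\<lambda>n. a n * f n w) summable_on {N..}" if "w \<in> unit_disc" for w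
    using abs_summ[OF that] by (rule abs_summable_summable)
  have norm_le: "norm (interp_sum N f a w) \<le> C * t" if w: "w \<in> unit_disc" for w
  proof -
    have "norm (interp_sum N f a w) \<le> (\<Sum>\<^sub>\<infinity>n\<in>{N..}. norm (a n * f n w))"
      unfolding interp_sum_def using abs_summ[OF w] by (rule norm_infsum_bound)
    also have "\<dots> \<le> (\<Sum>\<^sub>\<infinity>n\<in>{N..}. t * norm (f n w))"
      using abs_summ[OF w] summ_t[OF w] le by (intro infsum_mono) auto
    also have "\<dots> = t * (\<Sum>\<^sub>\<infinity>n\<in>{N..}. norm (f n w))"
      by (rule infsum_cmult_right')
    also have "\<dots> \<le> t * C"
      using sum_le[OF w] t by (rule mult_left_mono)
    finally show ?thesis by (simp add: mult.commute)
  qed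
  have "interp_sum N f a holomorphic_on unit_disc"
    unfolding interp_sum_def
  proof (rule holomorphic_infsum)
    show "(\<lambda>n. t * M n) summable_on {N..}"
      using M by (rule summable_on_cmult_right)
    show "norm (a n * f n w) \<le> t * M n / (1 - norm w)" if "n \<in> {N..}" "w \<in> unit_disc" for n w
    proof -
      have "norm (a n * f n w) \<le> t * norm (f n w)" using le that by simp
      also have "\<dots> \<le> t * (M n / (1 - norm w))"
        using that t bound by (intro mult_left_mono) auto
      finally show ?thesis by simp
    qed
  qed (auto intro!: holomorphic_intros hol)
  then show "interp_sum N f a \<in> Hinf"
    using norm_le unfolding Hinf_def bounded_iff by blast
  show "Hinf_norm (interp_sum N f a) \<le> C * linf_tail_norm N a"
    unfolding Hinf_norm_def using norm_le by (intro cSUP_least) (auto simp: t_def)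
qed

lemma interp_sum_at_node:
  assumes "N \<le> j" "f j w = 1" and "\<And>n. N \<le> n \<Longrightarrow> n \<noteq> j \<Longrightarrow> f n w = 0"
  shows "interp_sum N f a w = a j"
proof -
  have "interp_sum N f a w = (\<Sum>\<^sub>\<infinity>n\<in>{j}. a n * f n w)"
    unfolding interp_sum_def using assms by (intro infsum_cong_neutral) auto
  then show ?thesis using assms by simp
qed

section \<open>Choice of parameters and conclusion\<close>

text \<open>\<beta> comes first because c depends on it. Then small \<theta> > 0 works by
  continuity, as the expression at \<theta> = 0 is \<beta>/(\<beta> + 1).\<close>

lemma exists_parameters:
  fixes \<epsilon> :: real
  assumes "0 < \<epsilon>"
  obtains \<beta> \<theta> :: real where "0 \<le> \<beta>" "0 < \<theta>" "\<theta> \<le> 1" "3 * (\<beta> * (\<beta> + 1)) * \<theta> \<le> 1"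
    "1 / (1 + \<epsilon>) < \<beta> / (\<beta> + 1) * ((1 - \<theta>)\<^sup>2 * (1 - 3 * (\<beta> * (\<beta> + 1)) * \<theta>))"
proof -
  \<comment> \<open>This makes \<beta>/(\<beta> + 1) equal to 1/(1 + \<epsilon>/2), which exceeds
    1/(1 + \<epsilon>).\<close>
  define \<beta> where "\<beta> = 2 / \<epsilon>"
  define c where "c = \<beta> * (\<beta> + 1)"
  have \<beta>: "0 \<le> \<beta>" "1 / (1 + \<epsilon>) < \<beta> / (\<beta> + 1)"
    using assms by (auto simp: \<beta>_def field_simps)
  have "((\<lambda>\<theta>. \<beta> / (\<beta> + 1) * ((1 - \<theta>)\<^sup>2 * (1 - 3 * c * \<theta>))) \<longlongrightarrow>
      \<beta> / (\<beta> + 1) * ((1 - 0)\<^sup>2 * (1 - 3 * c * 0))) (at_right 0)"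
    by (intro tendsto_intros)
  then have 1: "\<forall>\<^sub>F \<theta> in at_right 0. 1 / (1 + \<epsilon>) < \<beta> / (\<beta> + 1) * ((1 - \<theta>)\<^sup>2 * (1 - 3 * c * \<theta>))"
    using \<beta> by (intro order_tendstoD(1)) auto
  have "((\<lambda>\<theta>. 3 * c * \<theta>) \<longlongrightarrow> 3 * c * 0) (at_right 0)"
    by (intro tendsto_intros)
  then have 2: "\<forall>\<^sub>F \<theta> in at_right 0. 3 * c * \<theta> < 1"
    by (intro order_tendstoD(2)) auto
  have 3: "\<forall>\<^sub>F \<theta> in at_right (0::real). \<theta> \<in> {0<..<1}"
    by (rule eventually_at_right_real) simp
  have "\<forall>\<^sub>F \<theta> in at_right 0. 0 < \<theta> \<and> \<theta> \<le> 1 \<and> 3 * c * \<theta> \<le> 1 \<and>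
      1 / (1 + \<epsilon>) < \<beta> / (\<beta> + 1) * ((1 - \<theta>)\<^sup>2 * (1 - 3 * c * \<theta>))"
    using 1 2 3 by eventually_elim auto
  then obtain \<theta> where "0 < \<theta>" "\<theta> \<le> 1" "3 * c * \<theta> \<le> 1"
      "1 / (1 + \<epsilon>) < \<beta> / (\<beta> + 1) * ((1 - \<theta>)\<^sup>2 * (1 - 3 * c * \<theta>))"
    by (auto dest!: eventually_happens)
  with \<beta>(1) that show thesis unfolding c_def by blast
qed

theorem theorem2p5:
  fixes z :: "nat \<Rightarrow> complex"
  assumes "thin_seq z"
  shows "\<forall>\<epsilon>::real. \<epsilon> > 0 \<longrightarrow>
    (\<exists>N\<ge>1. \<exists>f :: nat \<Rightarrow> complex \<Rightarrow> complex.
       (\<forall>n\<ge>N. f n \<in> Hinf) \<and>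
       (\<forall>n\<ge>N. \<forall>k\<ge>N. f n (z n) = 1 \<and> (k \<noteq> n \<longrightarrow> f n (z k) = 0)) \<and>
       (\<forall>w\<in>unit_disc. (\<lambda>n. norm (f n w)) summable_on {N..} \<and>
          (\<Sum>\<^sub>\<infinity>n\<in>{N..}. norm (f n w)) < 1 + \<epsilon>) \<and>
       (\<forall>a\<in>linf. linf_norm a \<le> 1 \<longrightarrow>
          (\<forall>w\<in>unit_disc. (\<lambda>n. a n * f n w) summable_on {N..}) \<and>
          interp_sum N f a \<in> Hinf \<and>
          Hinf_norm (interp_sum N f a) \<le> (1 + \<epsilon>) * linf_tail_norm N a \<and>
          (\<forall>j\<ge>N. interp_sum N f a (z j) = a j)))"
proof (intro allI impI)
  fix \<epsilon> :: real assume \<epsilon>: "0 < \<epsilon>"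
  obtain \<beta> \<theta> :: real where \<beta>: "0 \<le> \<beta>" and \<theta>: "0 < \<theta>" "\<theta> \<le> 1" "3 * (\<beta> * (\<beta> + 1)) * \<theta> \<le> 1"
    and \<kappa>: "1 / (1 + \<epsilon>) < \<beta> / (\<beta> + 1) * ((1 - \<theta>)\<^sup>2 * (1 - 3 * (\<beta> * (\<beta> + 1)) * \<theta>))"
    using exists_parameters[OF \<epsilon>] by blast
  define c where "c = \<beta> * (\<beta> + 1)"
  \<comment> \<open>A lower bound for |h_n(z_n)| common to all n, so normalising costs at most
    1/\<kappa>. The gap 1/\<kappa> < 1 + \<epsilon> keeps the bound strict after passing to infinite
    sums.\<close>
  define \<kappa> where "\<kappa> = \<beta> / (\<beta> + 1) * ((1 - \<theta>)\<^sup>2 * (1 - 3 * c * \<theta>))"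
  have \<kappa>1: "1 / (1 + \<epsilon>) < \<kappa>" using \<kappa> by (simp add: \<kappa>_def c_def)
  have "0 < 1 / (1 + \<epsilon>)" using \<epsilon> by simp
  then have \<kappa>0: "0 < \<kappa>" using \<kappa>1 by linarith
  have \<kappa>2: "1 / \<kappa> < 1 + \<epsilon>" using \<kappa>0 \<kappa>1 \<epsilon> by (simp add: field_simps)
  obtain N where N: "1 \<le> N"
    and radii: "\<And>K. finite K \<Longrightarrow> K \<subseteq> {N..} \<Longrightarrow> (\<Sum>k\<in>K. 1 - (norm (z k))\<^sup>2) \<le> \<theta>"
    and separation: "\<And>n K. N \<le> n \<Longrightarrow> finite K \<Longrightarrow> K \<subseteq> {N..} - {n} \<Longrightarrow>
           (\<Sum>k\<in>K. 1 - (pseudo_hyp (z n) (z k))\<^sup>2) \<le> \<theta>"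
    using thin_seq_tail_small[OF assms \<theta>(1)] by blast
  have disc: "z k \<in> unit_disc" if "N \<le> k" for k
    using that N by (intro thin_seq_disc[OF assms]) auto
  obtain h :: "nat \<Rightarrow> complex \<Rightarrow> complex" where
    hol: "\<And>n. N \<le> n \<Longrightarrow> h n holomorphic_on unit_disc" and
    zero: "\<And>n k. N \<le> n \<Longrightarrow> N \<le> k \<Longrightarrow> k \<noteq> n \<Longrightarrow> h n (z k) = 0" and
    lower: "\<And>n. N \<le> n \<Longrightarrow> \<kappa> \<le> norm (h n (z n))" and
    sum_h: "\<And>F w. w \<in> unit_disc \<Longrightarrow> finite F \<Longrightarrow> F \<subseteq> {N..} \<Longrightarrow> (\<Sum>n\<in>F. norm (h n w)) \<le> 1" and
    bound: "\<And>n w. N \<le> n \<Longrightarrow> w \<in> unit_disc \<Longrightarrow>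
       norm (h n w) \<le> 2 * c * (1 - (norm (z n))\<^sup>2) / (1 - norm w)"
    unfolding \<kappa>_def c_def
    using interpolating_family[OF disc \<beta> less_imp_le[OF \<theta>(1)] \<theta>(2,3) radii separation] by blast
  define f where "f n w = h n w / h n (z n)" for n w
  have nz: "h n (z n) \<noteq> 0" if "N \<le> n" for n
    using lower[OF that] \<kappa>0 by auto
  have f_le: "norm (f n w) \<le> norm (h n w) / \<kappa>" if "N \<le> n" for n w
    unfolding f_def norm_divide using lower[OF that] \<kappa>0 by (intro divide_left_mono mult_pos_pos) auto
  have f_hol: "f n holomorphic_on unit_disc" if "N \<le> n" for n
    unfolding f_def using hol[OF that] nz[OF that] by (intro holomorphic_intros)
  have node: "f n (z n) = 1 \<and> (k \<noteq> n \<longrightarrow> f n (z k) = 0)" if "N \<le> n" "N \<le> k" for n k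
    using that nz zero by (simp add: f_def)
  have fin: "(\<Sum>n\<in>F. norm (f n w)) \<le> 1 / \<kappa>" if "w \<in> unit_disc" "finite F" "F \<subseteq> {N..}" for F w
  proof -
    have "(\<Sum>n\<in>F. norm (f n w)) \<le> (\<Sum>n\<in>F. norm (h n w) / \<kappa>)"
      using that f_le by (intro sum_mono) auto
    also have "\<dots> = (\<Sum>n\<in>F. norm (h n w)) / \<kappa>"
      by (simp add: sum_divide_distrib)
    also have "\<dots> \<le> 1 / \<kappa>"
      using sum_h[OF that] \<kappa>0 by (intro divide_right_mono) auto
    finally show ?thesis .
  qed
  have summ: "(\<lambda>n. norm (f n w)) summable_on {N..}" if "w \<in> unit_disc" for w
    using fin[OF that] by (intro nonneg_bdd_above_summable_on bdd_aboveI2[where M = "1 / \<kappa>"]) auto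
  have sum_le: "(\<Sum>\<^sub>\<infinity>n\<in>{N..}. norm (f n w)) \<le> 1 / \<kappa>" if "w \<in> unit_disc" for w
    using summ[OF that] fin[OF that] by (rule infsum_le_finite_sums)
  have f_Hinf: "f n \<in> Hinf" if "N \<le> n" for n
  proof -
    have "norm (f n w) \<le> 1 / \<kappa>" if "w \<in> unit_disc" for w
      using fin[OF that, of "{n}"] \<open>N \<le> n\<close> by simp
    then show ?thesis
      using f_hol[OF that] unfolding Hinf_def bounded_iff by blast
  qed
  define M where "M n = 2 * c / \<kappa> * (1 - (norm (z n))\<^sup>2)" for n
  have M_bound: "norm (f n w) \<le> M n / (1 - norm w)" if "N \<le> n" "w \<in> unit_disc" for n w
  proof -
    have "norm (f n w) \<le> norm (h n w) / \<kappa>" by (rule f_le) fact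
    also have "\<dots> \<le> (2 * c * (1 - (norm (z n))\<^sup>2) / (1 - norm w)) / \<kappa>"
      using bound[OF that] \<kappa>0 by (intro divide_right_mono) auto
    finally show ?thesis by (simp add: M_def mult.commute)
  qed
  have "(\<lambda>n. 1 - (norm (z n))\<^sup>2) summable_on {N..}"
    using radii disc
    by (intro nonneg_bdd_above_summable_on bdd_aboveI2[where M = \<theta>]) (auto simp: norm_sq_le_1)
  then have M_summ: "M summable_on {N..}"
    unfolding M_def by (rule summable_on_cmult_right)
  have sum_le': "(\<Sum>\<^sub>\<infinity>n\<in>{N..}. norm (f n w)) \<le> 1 + \<epsilon>" if "w \<in> unit_disc" for w
    using sum_le[OF that] \<kappa>2 by linarith
  have interp: "(\<forall>w\<in>unit_disc. (\<lambda>n. a n * f n w) summable_on {N..}) \<and>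
      interp_sum N f a \<in> Hinf \<and>
      Hinf_norm (interp_sum N f a) \<le> (1 + \<epsilon>) * linf_tail_norm N a \<and>
      (\<forall>j\<ge>N. interp_sum N f a (z j) = a j)" if "a \<in> linf" for a
  proof -
    \<comment> \<open>\<open>linf\<close> bounds \<open>a\<close> on the indices from 1 on, and N
      \<ge> 1 places the tail among them.\<close>
    have "bounded (a ` {N..})"
      using that N by (auto simp: linf_def intro: bounded_subset)
    note props = interp_sum_properties[OF f_hol M_bound M_summ summ sum_le' this]
    show ?thesis
      using props node by (auto intro!: interp_sum_at_node)
  qed
  show "\<exists>N\<ge>1. \<exists>f :: nat \<Rightarrow> complex \<Rightarrow> complex.
       (\<forall>n\<ge>N. f n \<in> Hinf) \<and>
       (\<forall>n\<ge>N. \<forall>k\<ge>N. f n (z n) = 1 \<and> (k \<noteq> n \<longrightarrow> f n (z k) = 0)) \<and>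
       (\<forall>w\<in>unit_disc. (\<lambda>n. norm (f n w)) summable_on {N..} \<and>
          (\<Sum>\<^sub>\<infinity>n\<in>{N..}. norm (f n w)) < 1 + \<epsilon>) \<and>
       (\<forall>a\<in>linf. linf_norm a \<le> 1 \<longrightarrow>
          (\<forall>w\<in>unit_disc. (\<lambda>n. a n * f n w) summable_on {N..}) \<and>
          interp_sum N f a \<in> Hinf \<and>
          Hinf_norm (interp_sum N f a) \<le> (1 + \<epsilon>) * linf_tail_norm N a \<and>
          (\<forall>j\<ge>N. interp_sum N f a (z j) = a j))"
  proof (intro exI[of _ N] exI[of _ f] conjI N)
    show "\<forall>w\<in>unit_disc. (\<lambda>n. norm (f n w)) summable_on {N..} \<and>
          (\<Sum>\<^sub>\<infinity>n\<in>{N..}. norm (f n w)) < 1 + \<epsilon>"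
      using summ le_less_trans[OF sum_le \<kappa>2] by blast
  qed (use f_Hinf node interp in blast)+
qed

end
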